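(* Let $\Omega\subseteq\mathbb{R}^3$ be open and bounded with Lipschitz boundary $\Gamma=\partial\Omega$, where $\Gamma$ is a manifold on which the covariant derivative $\operatorname{grad}_\Gamma$ is defined. For the operator $\begin{pmatrix}\operatorname{grad}\\ \gamma\\ \operatorname{grad}_\Gamma\gamma\end{pmatrix}\colon D(\operatorname{grad}_\Gamma\gamma)\subseteq L^2(\Omega)\to L^2(\Omega)^3\oplus L^2(\Gamma)\oplus L^2_\tau(\Gamma)$ we have $$\begin{pmatrix}\operatorname{grad}\\ \gamma\\ \operatorname{grad}_\Gamma\gamma\end{pmatrix}^{*}\begin{pmatrix}v\\ \eta_1\\ \eta_2\end{pmatrix}=-\operatorname{div}v$$ with $$D\left(\begin{pmatrix}\operatorname{grad}\\ \gamma\\ \operatorname{grad}_\Gamma\gamma\end{pmatrix}^{*}\right)=\left\{(v,\eta_1,\eta_2)\in D(\operatorname{div})\times L^2(\Gamma)\times L^2_\tau(\Gamma)\;\middle|\;n\cdot v+\eta_1+\operatorname{grad}_\Gamma^{\diamond}\eta_2=0\text{ on }L^2(\Gamma)\right\}.$$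
   Context: $\gamma\colon H_1(\Omega)\to L^2(\Gamma)$, $\phi\mapsto\phi|_\Gamma$, is the trace mapping, and $n$ is the unit outward normal field on $\Gamma$. $L^2_\tau(\Gamma):=L^2(\Gamma)^2$, and $\operatorname{grad}_\Gamma\colon H_1(\Gamma)\subseteq L^2(\Gamma)\to L^2_\tau(\Gamma)$ is the covariant derivative on $\Gamma$, a densely defined closed operator; $H_1(\Gamma)=D(\operatorname{grad}_\Gamma)$ carries the graph norm. $\operatorname{grad}$ is the weak gradient and $D(\operatorname{grad}_\Gamma\gamma)=\{u\in H_1(\Omega)\mid\gamma u\in H_1(\Gamma)\}$. $D(\operatorname{div})$ is the set of $v\in L^2(\Omega)^3$ whose distributional divergence $\operatorname{div}v$ lies in $L^2(\Omega)$. Inner products are linear in the second argument; $X'$ is the dual of $X$. $\operatorname{grad}_\Gamma^{\diamond}\colon L^2_\tau(\Gamma)\to H_1(\Gamma)'$ is defined by $(\operatorname{grad}_\Gamma^{\diamond}\eta)(g):=\langle\eta|\operatorname{grad}_\Gamma g\rangle_{L^2_\tau(\Gamma)}$ for $g\in H_1(\Gamma)$. Let $H_{1/2}(\Gamma):=\gamma[H_1(\Omega)]$. For $v\in D(\operatorname{div})$, $n\cdot v\in H_{1/2}(\Gamma)'$ is the functional with $(n\cdot v)(\gamma\psi)=\langle\operatorname{div}v|\psi\rangle_{L^2(\Omega)}+\langle v|\operatorname{grad}\psi\rangle_{L^2(\Omega)^3}$ for all $\psi\in H_1(\Omega)$. One has $H_1(\Gamma)\subseteq H_{1/2}(\Gamma)\subseteq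 L^2(\Gamma)$. The condition "$n\cdot v+\eta_1+\operatorname{grad}_\Gamma^{\diamond}\eta_2=0$ on $L^2(\Gamma)$" means that the functional $g\mapsto(n\cdot v)(g)+\langle\eta_1|g\rangle_{L^2(\Gamma)}+(\operatorname{grad}_\Gamma^{\diamond}\eta_2)(g)$, defined for $g\in H_1(\Gamma)$, vanishes (equivalently, it extends continuously to the zero functional on $L^2(\Gamma)$). *)

theory Defs
  imports "HOL-Analysis.Analysis"
begin

text \<open>
  Conventions. The scalar field is \<open>\<complex>\<close>. An element of an \<open>L\<^sup>2\<close> space is represented by a
  square-integrable function; two functions represent the same element iff they agree almost
  everywhere. A (possibly unbounded) operator is represented by its graph, a set of pairs of
  representatives that is closed under almost-everywhere equality; its domain is the
  \<open>Domain\<close> of that graph, and "\<open>A x = y\<close>" reads \<open>(x, y) \<in> A\<close>.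
\<close>

type_synonym R3 = "real ^ 3"
type_synonym scal = "real ^ 3 \<Rightarrow> complex"
type_synonym 'n vect = "real ^ 3 \<Rightarrow> complex ^ 'n"


subsection \<open>\<open>L\<^sup>2\<close> spaces\<close>

definition L2 :: "R3 measure \<Rightarrow> scal set" where
  "L2 M = {f \<in> borel_measurable M. integrable M (\<lambda>x. (cmod (f x))\<^sup>2)}"

definition L2v :: "R3 measure \<Rightarrow> ('n::finite) vect set" where
  "L2v M = {f. \<forall>i. (\<lambda>x. f x $ i) \<in> L2 M}"

definition ip :: "R3 measure \<Rightarrow> scal \<Rightarrow> scal \<Rightarrow> complex" where
  "ip M f g = (LINT x|M. cnj (f x) * g x)"

definition ipv :: "R3 measure \<Rightarrow> ('n::finite) vect \<Rightarrow> 'n vect \<Rightarrow> complex" where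
  "ipv M f g = (\<Sum>i\<in>UNIV. ip M (\<lambda>x. f x $ i) (\<lambda>x. g x $ i))"

text \<open>Convergence in the \<open>L\<^sup>2\<close> norm; the extended integral avoids the convention that the
  Bochner integral of a non-integrable function is \<open>0\<close>.\<close>

definition L2_lim :: "R3 measure \<Rightarrow> (nat \<Rightarrow> scal) \<Rightarrow> scal \<Rightarrow> bool" where
  "L2_lim M f g \<longleftrightarrow> (\<lambda>k. \<integral>\<^sup>+x. ennreal ((cmod (f k x - g x))\<^sup>2) \<partial>M) \<longlonglongrightarrow> 0"


subsection \<open>Operators as graphs\<close>

definition app :: "('a \<times> 'b) set \<Rightarrow> 'a \<Rightarrow> 'b" where
  "app A x = (SOME y. (x, y) \<in> A)"

definition adjoint ::
  "'a set \<Rightarrow> ('a \<Rightarrow> 'a \<Rightarrow> complex) \<Rightarrow> 'b set \<Rightarrow> ('b \<Rightarrow> 'b \<Rightarrow> complex) \<Rightarrow> ('a \<times> 'b) set \<Rightarrow> ('b \<times> 'a) set"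
  where
  "adjoint H ipH K ipK A =
     {(y, f). y \<in> K \<and> f \<in> H \<and> (\<forall>x z. (x, z) \<in> A \<longrightarrow> ipK y z = ipH f x)}"


subsection \<open>Smooth functions and test functions\<close>

definition partial :: "3 \<Rightarrow> scal \<Rightarrow> scal" where
  "partial i f x = frechet_derivative f (at x) (axis i 1)"

primrec Ck :: "nat \<Rightarrow> scal \<Rightarrow> bool" where
  "Ck 0 f \<longleftrightarrow> continuous_on UNIV f"
| "Ck (Suc k) f \<longleftrightarrow> (\<forall>x. f differentiable (at x)) \<and> (\<forall>i. Ck k (partial i f))"

definition smooth :: "scal \<Rightarrow> bool" where
  "smooth f \<longleftrightarrow> (\<forall>k. Ck k f)"

definition test_fun :: "R3 set \<Rightarrow> scal set" where
  "test_fun \<Omega> = {\<phi>. smooth \<phi> \<and> (\<exists>K. compact K \<and> K \<subseteq> \<Omega> \<and> (\<forall>x. x \<notin> K \<longrightarrow> \<phi> x = 0))}"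


subsection \<open>Weak gradient and distributional divergence\<close>

abbreviation vol :: "R3 set \<Rightarrow> R3 measure" where
  "vol \<Omega> \<equiv> lebesgue_on \<Omega>"

definition gradient :: "R3 set \<Rightarrow> (scal \<times> 3 vect) set" where
  "gradient \<Omega> = {(u, w). u \<in> L2 (vol \<Omega>) \<and> w \<in> L2v (vol \<Omega>) \<and>
     (\<forall>\<phi>\<in>test_fun \<Omega>. \<forall>i.
        (LINT x|vol \<Omega>. u x * partial i \<phi> x) = - (LINT x|vol \<Omega>. w x $ i * \<phi> x))}"

definition divergence :: "R3 set \<Rightarrow> (3 vect \<times> scal) set" where
  "divergence \<Omega> = {(v, d). v \<in> L2v (vol \<Omega>) \<and> d \<in> L2 (vol \<Omega>) \<and>
     (\<forall>\<phi>\<in>test_fun \<Omega>.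
        (\<Sum>i\<in>UNIV. LINT x|vol \<Omega>. v x $ i * partial i \<phi> x) = - (LINT x|vol \<Omega>. d x * \<phi> x))}"

definition H1_norm :: "R3 set \<Rightarrow> scal \<Rightarrow> 3 vect \<Rightarrow> real" where
  "H1_norm \<Omega> u w = sqrt (Re (ip (vol \<Omega>) u u) + Re (ipv (vol \<Omega>) w w))"


subsection \<open>The boundary\<close>

text \<open>Near each boundary point, and after a rotation taking \<open>e\<close> to the third coordinate axis,
  \<open>\<Omega>\<close> is the region strictly below the graph of a Lipschitz function \<open>a\<close> defined on
  the plane orthogonal to \<open>e\<close>.\<close>

definition lipschitz_boundary :: "R3 set \<Rightarrow> bool" where
  "lipschitz_boundary \<Omega> \<longleftrightarrow>
     (\<forall>p\<in>frontier \<Omega>. \<exists>U e L a. open U \<and> p \<in> U \<and> norm e = 1 \<and>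
        L-lipschitz_on {y. y \<bullet> e = 0} a \<and>
        \<Omega> \<inter> U = {x \<in> U. x \<bullet> e < a (x - (x \<bullet> e) *\<^sub>R e)})"

text \<open>Two-dimensional Hausdorff measure, normalised by \<open>\<pi>/4\<close> so that it is the usual area on
  planes. Bounded covering sets are required because \<open>diameter\<close> is meaningful only for them.\<close>

definition hausdorff2_pre :: "real \<Rightarrow> R3 set \<Rightarrow> ennreal" where
  "hausdorff2_pre \<delta> A =
     (INF U \<in> {U :: nat \<Rightarrow> R3 set. A \<subseteq> (\<Union>i. U i) \<and> (\<forall>i. bounded (U i) \<and> diameter (U i) \<le> \<delta>)}.
        \<Sum>i. ennreal (pi / 4 * (diameter (U i))\<^sup>2))"

definition hausdorff2 :: "R3 measure" where
  "hausdorff2 = measure_of UNIV (sets borel) (\<lambda>A. SUP \<delta>\<in>{0<..}. hausdorff2_pre \<delta> A)"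

definition surf :: "R3 set \<Rightarrow> R3 measure" where
  "surf \<Omega> = restrict_space hausdorff2 (frontier \<Omega>)"

text \<open>The first limit says that the plane orthogonal to \<open>\<nu>\<close> is tangent to the boundary at \<open>x\<close>.
  On a Lipschitz boundary such a \<open>\<nu>\<close> exists at almost every point.\<close>

definition outward_normal :: "R3 set \<Rightarrow> R3 \<Rightarrow> R3 \<Rightarrow> bool" where
  "outward_normal \<Omega> x \<nu> \<longleftrightarrow> x \<in> frontier \<Omega> \<and> norm \<nu> = 1 \<and>
     ((\<lambda>y. ((y - x) \<bullet> \<nu>) / norm (y - x)) \<longlongrightarrow> 0) (at x within frontier \<Omega>) \<and>
     (\<forall>\<^sub>F t in at_right 0. x + t *\<^sub>R \<nu> \<notin> \<Omega> \<and> x - t *\<^sub>R \<nu> \<in> \<Omega>)"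

text \<open>Tangential \<open>L\<^sup>2\<close> fields are identified with \<open>L\<^sup>2(\<Gamma>)\<^sup>2\<close> by their components with respect to a
  measurable orthonormal frame of the tangent planes.\<close>

definition tangent_frame :: "R3 set \<Rightarrow> (R3 \<Rightarrow> R3 ^ 2) \<Rightarrow> bool" where
  "tangent_frame \<Omega> \<tau> \<longleftrightarrow> \<tau> \<in> borel_measurable (surf \<Omega>) \<and>
     (AE x in surf \<Omega>.
        (\<exists>\<nu>. outward_normal \<Omega> x \<nu> \<and> (\<forall>j. (\<tau> x $ j) \<bullet> \<nu> = 0)) \<and>
        (\<forall>i j. (\<tau> x $ i) \<bullet> (\<tau> x $ j) = (if i = j then 1 else 0)))"


subsection \<open>Trace and covariant derivative\<close>

text \<open>\<open>\<gamma>\<close> is the continuous extension to \<open>H\<^sub>1(\<Omega>)\<close> of the restriction \<open>\<phi> \<mapsto> \<phi>|\<^sub>\<Gamma>\<close> of smooth functions,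
  which are dense in \<open>H\<^sub>1(\<Omega>)\<close> when the boundary is Lipschitz.\<close>

definition trace_map :: "R3 set \<Rightarrow> (scal \<times> scal) set" where
  "trace_map \<Omega> = {(u, g). g \<in> L2 (surf \<Omega>) \<and>
     (\<exists>w \<phi>. (u, w) \<in> gradient \<Omega> \<and> (\<forall>k. smooth (\<phi> k)) \<and>
        L2_lim (vol \<Omega>) \<phi> u \<and>
        (\<forall>i. L2_lim (vol \<Omega>) (\<lambda>k. partial i (\<phi> k)) (\<lambda>x. w x $ i)) \<and>
        L2_lim (surf \<Omega>) \<phi> g)}"

definition H_half :: "R3 set \<Rightarrow> scal set" where
  "H_half \<Omega> = Range (trace_map \<Omega>)"

text \<open>The dual of \<open>H\<^sub>1\<^sub>/\<^sub>2(\<Gamma>)\<close> with the quotient norm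
  \<open>\<parallel>g\<parallel> = inf {\<parallel>\<psi>\<parallel> | \<psi> \<in> H\<^sub>1(\<Omega>), \<gamma>\<psi> = g}\<close>. Only the values of \<open>F\<close> on
  \<open>H_half\<close> matter (recall \<open>H\<^sub>1(\<Gamma>) \<subseteq> H\<^sub>1\<^sub>/\<^sub>2(\<Gamma>)\<close>).\<close>

definition H_half_dual :: "R3 set \<Rightarrow> (scal \<Rightarrow> complex) set" where
  "H_half_dual \<Omega> = {F.
     (\<forall>g\<in>H_half \<Omega>. \<forall>h\<in>H_half \<Omega>. \<forall>a b. F (\<lambda>x. a * g x + b * h x) = a * F g + b * F h) \<and>
     (\<exists>C. \<forall>\<psi> w g. (\<psi>, w) \<in> gradient \<Omega> \<longrightarrow> (\<psi>, g) \<in> trace_map \<Omega> \<longrightarrow>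
        cmod (F g) \<le> C * H1_norm \<Omega> \<psi> w)}"

text \<open>\<open>F\<close> is the functional \<open>n \<cdot> v\<close>; here \<open>d\<close> is \<open>div v\<close> and \<open>w\<close> is \<open>grad \<psi>\<close>.\<close>

definition is_normal_trace :: "R3 set \<Rightarrow> 3 vect \<Rightarrow> (scal \<Rightarrow> complex) \<Rightarrow> bool" where
  "is_normal_trace \<Omega> v F \<longleftrightarrow> F \<in> H_half_dual \<Omega> \<and>
     (\<exists>d. (v, d) \<in> divergence \<Omega> \<and>
        (\<forall>\<psi> w g. (\<psi>, w) \<in> gradient \<Omega> \<longrightarrow> (\<psi>, g) \<in> trace_map \<Omega> \<longrightarrow>
           F g = ip (vol \<Omega>) d \<psi> + ipv (vol \<Omega>) v w))"

text \<open>The covariant derivative is the closure, in the graph norm, of the tangential gradient of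
  smooth functions; \<open>frechet_derivative \<phi> (at x) (\<tau> x $ j)\<close> is the component of the latter along the
  tangent vector \<open>\<tau> x $ j\<close>. It is defined on \<open>\<Gamma>\<close> as an operator if this closure is single-valued.\<close>

definition grad_bd :: "R3 set \<Rightarrow> (R3 \<Rightarrow> R3 ^ 2) \<Rightarrow> (scal \<times> 2 vect) set" where
  "grad_bd \<Omega> \<tau> = {(g, h). g \<in> L2 (surf \<Omega>) \<and> h \<in> L2v (surf \<Omega>) \<and>
     (\<exists>\<phi>. (\<forall>k. smooth (\<phi> k)) \<and> L2_lim (surf \<Omega>) \<phi> g \<and>
        (\<forall>j. L2_lim (surf \<Omega>)
               (\<lambda>k x. frechet_derivative (\<phi> k) (at x) (\<tau> x $ j)) (\<lambda>x. h x $ j)))}"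

definition grad_bd_defined :: "R3 set \<Rightarrow> (R3 \<Rightarrow> R3 ^ 2) \<Rightarrow> bool" where
  "grad_bd_defined \<Omega> \<tau> \<longleftrightarrow> (\<forall>g h h'. (g, h) \<in> grad_bd \<Omega> \<tau> \<longrightarrow> (g, h') \<in> grad_bd \<Omega> \<tau> \<longrightarrow>
     (AE x in surf \<Omega>. h x = h' x))"

definition H1_bd :: "R3 set \<Rightarrow> (R3 \<Rightarrow> R3 ^ 2) \<Rightarrow> scal set" where
  "H1_bd \<Omega> \<tau> = Domain (grad_bd \<Omega> \<tau>)"

definition grad_bd_diamond :: "R3 set \<Rightarrow> (R3 \<Rightarrow> R3 ^ 2) \<Rightarrow> 2 vect \<Rightarrow> scal \<Rightarrow> complex" where
  "grad_bd_diamond \<Omega> \<tau> \<eta> g = ipv (surf \<Omega>) \<eta> (app (grad_bd \<Omega> \<tau>) g)"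


subsection \<open>The operator \<open>(grad, \<gamma>, grad\<^sub>\<Gamma> \<gamma>)\<close>\<close>

definition triple_op ::
  "R3 set \<Rightarrow> (R3 \<Rightarrow> R3 ^ 2) \<Rightarrow> (scal \<times> (3 vect \<times> scal \<times> 2 vect)) set" where
  "triple_op \<Omega> \<tau> = {(u, (w, g, h)).
     (u, w) \<in> gradient \<Omega> \<and> (u, g) \<in> trace_map \<Omega> \<and> (g, h) \<in> grad_bd \<Omega> \<tau>}"

definition ip_sum ::
  "R3 set \<Rightarrow> 3 vect \<times> scal \<times> 2 vect \<Rightarrow> 3 vect \<times> scal \<times> 2 vect \<Rightarrow> complex" where
  "ip_sum \<Omega> = (\<lambda>(v, \<eta>1, \<eta>2) (w, g, h).
     ipv (vol \<Omega>) v w + ip (surf \<Omega>) \<eta>1 g + ipv (surf \<Omega>) \<eta>2 h)"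

definition triple_adj ::
  "R3 set \<Rightarrow> (R3 \<Rightarrow> R3 ^ 2) \<Rightarrow> ((3 vect \<times> scal \<times> 2 vect) \<times> scal) set" where
  "triple_adj \<Omega> \<tau> = adjoint (L2 (vol \<Omega>)) (ip (vol \<Omega>))
     (L2v (vol \<Omega>) \<times> L2 (surf \<Omega>) \<times> L2v (surf \<Omega>)) (ip_sum \<Omega>) (triple_op \<Omega> \<tau>)"

end

theory Submission
  imports Defs
begin

text \<open>
  Testing the adjoint condition with test functions, whose trace vanishes, gives \<open>f = - div v\<close>.
  Testing it with \<open>\<psi>\<close> in the kernel of \<open>\<gamma>\<close> shows that \<open>\<langle>div v|\<psi>\<rangle> + \<langle>v|grad \<psi>\<rangle>\<close> depends only on
  \<open>\<gamma>\<psi>\<close>, so \<open>n \<cdot> v\<close> is well defined without identifying that kernel with the closure of the test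
  functions; on \<open>H\<^sub>1(\<Gamma>)\<close> the adjoint condition and the defining formula of \<open>n \<cdot> v\<close> differ exactly
  by the boundary condition.
\<close>

subsection \<open>Square-integrable functions\<close>

lemma L2_measurable: "f \<in> L2 M \<Longrightarrow> f \<in> borel_measurable M"
  by (simp add: L2_def)

lemma L2_integrable: "f \<in> L2 M \<Longrightarrow> integrable M (\<lambda>x. (cmod (f x))\<^sup>2)"
  by (simp add: L2_def)

text \<open>Triangle inequality, then \<open>2 * p * q \<le> p\<^sup>2 + q\<^sup>2\<close>. The loss
  of a factor 2 is harmless both for square integrability and for null limits of squared
  distances.\<close>

lemma norm_lincomb_square_le:
  fixes a b x y :: complex
  shows "(cmod (a * x + b * y))\<^sup>2 \<le> 2 * (cmod a)\<^sup>2 * (cmod x)\<^sup>2 + 2 * (cmod b)\<^sup>2 * (cmod y)\<^sup>2"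
proof -
  have "(cmod (a * x + b * y))\<^sup>2 \<le> (cmod a * cmod x + cmod b * cmod y)\<^sup>2"
    by (intro power_mono) (metis norm_mult norm_triangle_ineq, simp)
  also have "\<dots> \<le> 2 * (cmod a * cmod x)\<^sup>2 + 2 * (cmod b * cmod y)\<^sup>2"
    using sum_squares_bound[of "cmod a * cmod x" "cmod b * cmod y"]
    by (simp add: power2_sum)
  finally show ?thesis by (simp add: power_mult_distrib)
qed

lemma L2_lincomb:
  assumes "f \<in> L2 M" "g \<in> L2 M"
  shows "(\<lambda>x. a * f x + b * g x) \<in> L2 M"
proof -
  note [measurable] = assms[THEN L2_measurable]
  have "integrable M (\<lambda>x. 2 * (cmod a)\<^sup>2 * (cmod (f x))\<^sup>2 + 2 * (cmod b)\<^sup>2 * (cmod (g x))\<^sup>2)"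
    using assms[THEN L2_integrable] by (intro Bochner_Integration.integrable_add integrable_mult_right)
  then have "integrable M (\<lambda>x. (cmod (a * f x + b * g x))\<^sup>2)"
    by (rule Bochner_Integration.integrable_bound) (use norm_lincomb_square_le in \<open>auto intro!: AE_I2\<close>)
  then show ?thesis by (simp add: L2_def)
qed

lemma L2_zero [simp]: "(\<lambda>x. 0) \<in> L2 M"
  by (simp add: L2_def)

lemma L2_cnj:
  assumes "f \<in> L2 M"
  shows "(\<lambda>x. cnj (f x)) \<in> L2 M"
proof -
  have "(\<lambda>x. cnj (f x)) \<in> borel_measurable M"
    by (rule borel_measurable_continuous_on[OF _ L2_measurable[OF assms]]) (intro continuous_intros)
  then show ?thesis using L2_integrable[OF assms] by (simp add: L2_def)
qed

text \<open>The product is dominated by the sum of the two squared moduli. No conjugate appears, so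
  the same fact serves the bilinear pairings with test functions and, through \<open>L2_cnj\<close>,
  the inner products.\<close>

lemma L2_times_integrable:
  assumes "f \<in> L2 M" "g \<in> L2 M"
  shows "integrable M (\<lambda>x. f x * g x)"
proof -
  note [measurable] = assms[THEN L2_measurable]
  have "integrable M (\<lambda>x. (cmod (f x))\<^sup>2 + (cmod (g x))\<^sup>2)"
    using assms[THEN L2_integrable] by (rule Bochner_Integration.integrable_add)
  then show ?thesis
  proof (rule Bochner_Integration.integrable_bound)
    show "AE x in M. cmod (f x * g x) \<le> norm ((cmod (f x))\<^sup>2 + (cmod (g x))\<^sup>2)"
    proof (rule AE_I2)
      fix x
      have "0 \<le> cmod (f x) * cmod (g x)" by simp
      then have "cmod (f x * g x) \<le> (cmod (f x))\<^sup>2 + (cmod (g x))\<^sup>2"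
        unfolding norm_mult using sum_squares_bound[of "cmod (f x)" "cmod (g x)"] by linarith
      then show "cmod (f x * g x) \<le> norm ((cmod (f x))\<^sup>2 + (cmod (g x))\<^sup>2)" by simp
    qed
  qed measurable
qed

lemma L2v_component: "f \<in> L2v M \<Longrightarrow> (\<lambda>x. f x $ i) \<in> L2 M"
  by (simp add: L2v_def)

lemma L2v_lincomb:
  assumes "f \<in> L2v M" "g \<in> L2v M"
  shows "(\<lambda>x. a *s f x + b *s g x) \<in> L2v M"
  using assms by (simp add: L2v_def L2_lincomb)

lemma L2v_zero [simp]: "(\<lambda>x. 0) \<in> L2v M"
  by (simp add: L2v_def)

section \<open>Inner products and the Cauchy-Schwarz inequality\<close>

lemma ip_lincomb:
  assumes "f \<in> L2 M" "g \<in> L2 M" "h \<in> L2 M"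
  shows "ip M f (\<lambda>x. a * g x + b * h x) = a * ip M f g + b * ip M f h"
proof -
  have "ip M f (\<lambda>x. a * g x + b * h x)
      = (LINT x|M. a * (cnj (f x) * g x) + b * (cnj (f x) * h x))"
    by (simp add: ip_def algebra_simps)
  also have "\<dots> = a * ip M f g + b * ip M f h"
    using assms by (simp add: ip_def L2_times_integrable L2_cnj)
  finally show ?thesis .
qed

lemma ip_zero [simp]: "ip M f (\<lambda>x. 0) = 0"
  by (simp add: ip_def)

lemma ipv_lincomb:
  assumes "f \<in> L2v M" "g \<in> L2v M" "h \<in> L2v M"
  shows "ipv M f (\<lambda>x. a *s g x + b *s h x) = a * ipv M f g + b * ipv M f h"
  using assms
  by (simp add: ipv_def ip_lincomb L2v_component sum.distrib sum_distrib_left)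

lemma ipv_zero [simp]: "ipv M f (\<lambda>x. 0) = 0"
  by (simp add: ipv_def)

lemma ip_self: "ip M f f = complex_of_real (LINT x|M. (cmod (f x))\<^sup>2)"
proof -
  have "ip M f f = (LINT x|M. complex_of_real ((cmod (f x))\<^sup>2))"
    unfolding ip_def
    by (intro Bochner_Integration.integral_cong) (simp_all only: complex_norm_square mult.commute)
  then show ?thesis by (simp only: integral_complex_of_real)
qed

lemma Re_ip_self_nonneg: "0 \<le> Re (ip M f f)"
  by (simp add: ip_self)

text \<open>Discriminant argument for a real quadratic in \<open>s\<close> that is never negative,
  built from the moduli. The case of a vanishing leading coefficient is settled by the quadratic
  itself, without passing to almost-everywhere statements.\<close>

lemma ip_Cauchy_Schwarz:
  assumes f: "f \<in> L2 M" and g: "g \<in> L2 M"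
  shows "cmod (ip M f g) \<le> sqrt (Re (ip M f f)) * sqrt (Re (ip M g g))"
proof -
  define F where "F = (LINT x|M. (cmod (f x))\<^sup>2)"
  define G where "G = (LINT x|M. (cmod (g x))\<^sup>2)"
  define I where "I = (LINT x|M. cmod (f x) * cmod (g x))"
  have int: "integrable M (\<lambda>x. cmod (f x) * cmod (g x))"
    using integrable_norm[OF L2_times_integrable[OF f g]] by (simp add: norm_mult)
  have quad: "0 \<le> F * s\<^sup>2 + - (2 * I) * s + G" for s
  proof -
    have "0 \<le> (LINT x|M. (s * cmod (f x) - cmod (g x))\<^sup>2)" by simp
    also have "\<dots> = (LINT x|M. s\<^sup>2 * (cmod (f x))\<^sup>2 - 2 * s * (cmod (f x) * cmod (g x)) + (cmod (g x))\<^sup>2)"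
      by (intro Bochner_Integration.integral_cong) (simp_all add: power2_eq_square algebra_simps)
    also have "\<dots> = s\<^sup>2 * F - 2 * s * I + G"
      using int L2_integrable[OF f] L2_integrable[OF g] by (simp add: F_def G_def I_def)
    finally show ?thesis by (simp add: algebra_simps)
  qed
  have I0: "0 \<le> I" and F0: "0 \<le> F" and G0: "0 \<le> G" by (simp_all add: I_def F_def G_def)
  have "I\<^sup>2 \<le> F * G"
  proof (cases "F = 0")
    case True
    have "I = 0"
    proof (rule ccontr)
      assume "I \<noteq> 0"
      \<comment> \<open>The quadratic has become affine in \<open>s\<close>; at this point its value
        is \<open>-1\<close>.\<close>
      with quad[of "(G + 1) / (2 * I)"] True show False by simp
    qed
    with True show ?thesis by simp
  next
    case False
    \<comment> \<open>The minimiser of the quadratic, where its value is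
      \<open>G - I\<^sup>2 / F\<close>.\<close>
    with quad[of "I / F"] F0 show ?thesis
      by (simp add: field_simps power2_eq_square)
  qed
  then have "I \<le> sqrt (F * G)" using real_le_rsqrt by blast
  moreover have "cmod (ip M f g) \<le> I"
    unfolding ip_def I_def using integral_norm_bound[of M "\<lambda>x. cnj (f x) * g x"] by (simp add: norm_mult)
  ultimately show ?thesis by (simp add: ip_self F_def G_def real_sqrt_mult)
qed

section \<open>Convergence in the L2 norm\<close>

lemma L2_lim_const: "(\<And>x. x \<in> space M \<Longrightarrow> f x = g x) \<Longrightarrow> L2_lim M (\<lambda>k. f) g"
  by (simp add: L2_lim_def cong: nn_integral_cong)

text \<open>The squared distance is bounded pointwise by \<open>norm_lincomb_square_le\<close> and
  the bound is integrated; measurability lets the integral of the sum split.\<close>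

lemma L2_lim_lincomb:
  assumes [measurable]: "\<And>k. f k \<in> borel_measurable M" "\<And>k. f' k \<in> borel_measurable M"
    "g \<in> borel_measurable M" "g' \<in> borel_measurable M"
    and lim: "L2_lim M f g" "L2_lim M f' g'"
  shows "L2_lim M (\<lambda>k x. a * f k x + b * f' k x) (\<lambda>x. a * g x + b * g' x)"
proof -
  let ?I = "\<lambda>f g k. \<integral>\<^sup>+x. ennreal ((cmod (f k x - g x))\<^sup>2) \<partial>M"
  define A where "A = ennreal (2 * (cmod a)\<^sup>2)"
  define B where "B = ennreal (2 * (cmod b)\<^sup>2)"
  have bound: "?I (\<lambda>k x. a * f k x + b * f' k x) (\<lambda>x. a * g x + b * g' x) k
      \<le> A * ?I f g k + B * ?I f' g' k" for k
  proof -
    have "?I (\<lambda>k x. a * f k x + b * f' k x) (\<lambda>x. a * g x + b * g' x) k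
        \<le> (\<integral>\<^sup>+x. A * ennreal ((cmod (f k x - g x))\<^sup>2) + B * ennreal ((cmod (f' k x - g' x))\<^sup>2) \<partial>M)"
    proof (rule nn_integral_mono)
      fix x
      have "(cmod (a * f k x + b * f' k x - (a * g x + b * g' x)))\<^sup>2
          = (cmod (a * (f k x - g x) + b * (f' k x - g' x)))\<^sup>2"
        by (simp add: algebra_simps)
      also note norm_lincomb_square_le
      finally have "ennreal ((cmod (a * f k x + b * f' k x - (a * g x + b * g' x)))\<^sup>2)
          \<le> ennreal (2 * (cmod a)\<^sup>2 * (cmod (f k x - g x))\<^sup>2 + 2 * (cmod b)\<^sup>2 * (cmod (f' k x - g' x))\<^sup>2)"
        by (rule ennreal_leI)
      also have "\<dots> = A * ennreal ((cmod (f k x - g x))\<^sup>2) + B * ennreal ((cmod (f' k x - g' x))\<^sup>2)"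
        unfolding A_def B_def by (subst ennreal_plus) (simp_all only: ennreal_mult mult_nonneg_nonneg
            zero_le_power2 zero_le_numeral)
      finally show "ennreal ((cmod (a * f k x + b * f' k x - (a * g x + b * g' x)))\<^sup>2)
          \<le> A * ennreal ((cmod (f k x - g x))\<^sup>2) + B * ennreal ((cmod (f' k x - g' x))\<^sup>2)" .
    qed
    also have "\<dots> = A * ?I f g k + B * ?I f' g' k"
      by (simp add: nn_integral_add nn_integral_cmult)
    finally show ?thesis .
  qed
  \<comment> \<open>\<open>A\<close> and \<open>B\<close> are finite, so multiplication by them
    preserves limits of extended nonnegative reals.\<close>
  have "(\<lambda>k. A * ?I f g k + B * ?I f' g' k) \<longlonglongrightarrow> A * 0 + B * 0"
    using lim unfolding L2_lim_def
    by (intro tendsto_add ennreal_tendsto_cmult) (auto simp: A_def B_def)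
  then have "(\<lambda>k. A * ?I f g k + B * ?I f' g' k) \<longlonglongrightarrow> 0" by simp
  from tendsto_sandwich[OF _ _ tendsto_const this] show ?thesis
    unfolding L2_lim_def using bound by simp
qed

subsection \<open>Smooth functions and integration by parts\<close>

lemma frechet_derivative_lincomb:
  fixes f g :: scal
  assumes "f differentiable (at x)" "g differentiable (at x)"
  shows "frechet_derivative (\<lambda>x. a * f x + b * g x) (at x) v
    = a * frechet_derivative f (at x) v + b * frechet_derivative g (at x) v"
proof -
  have "((\<lambda>x. a * f x + b * g x) has_derivative
      (\<lambda>v. a * frechet_derivative f (at x) v + b * frechet_derivative g (at x) v)) (at x)"
    using assms[unfolded frechet_derivative_works]
    by (auto intro!: derivative_eq_intros)
  from frechet_derivative_at[OF this] show ?thesis by metis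
qed

text \<open>The induction generalises both functions, since its step passes from \<open>f\<close>
  and \<open>g\<close> to their partial derivatives.\<close>

lemma Ck_lincomb: "Ck k f \<Longrightarrow> Ck k g \<Longrightarrow> Ck k (\<lambda>x. a * f x + b * g x)"
proof (induction k arbitrary: f g)
  case 0
  then show ?case by (auto intro!: continuous_intros)
next
  case (Suc k)
  then have "partial i (\<lambda>x. a * f x + b * g x) = (\<lambda>x. a * partial i f x + b * partial i g x)" for i
    by (auto simp: partial_def frechet_derivative_lincomb)
  with Suc show ?case by (auto intro!: derivative_intros)
qed

text \<open>Conjugation is a bounded real-linear map, so it commutes with the Frechet derivative.
  Conjugated test functions arise because \<open>ip\<close> conjugates its first argument whereas
  \<open>divergence\<close> pairs without conjugation.\<close>

lemma Ck_cnj: "Ck k f \<Longrightarrow> Ck k (\<lambda>x. cnj (f x))"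
  and partial_cnj: "(\<And>x. f differentiable (at x)) \<Longrightarrow> partial i (\<lambda>x. cnj (f x)) = (\<lambda>x. cnj (partial i f x))"
proof -
  have der: "((\<lambda>x. cnj (f x)) has_derivative (\<lambda>v. cnj (frechet_derivative f (at x) v))) (at x)"
    if "f differentiable (at x)" for f :: scal and x
    using that by (intro bounded_linear.has_derivative[OF bounded_linear_cnj])
      (simp add: frechet_derivative_works)
  have part: "partial i (\<lambda>x. cnj (f x)) = (\<lambda>x. cnj (partial i f x))"
    if "\<And>x. f differentiable (at x)" for i and f :: scal
    unfolding partial_def using frechet_derivative_at[OF der[OF that]] by metis
  show "Ck k f \<Longrightarrow> Ck k (\<lambda>x. cnj (f x))"
  proof (induction k arbitrary: f)
    case 0
    then show ?case by (auto intro!: continuous_intros)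
  next
    case (Suc k)
    then have "f differentiable (at x)" for x by simp
    with Suc show ?case by (auto simp: part intro!: differentiableI[OF der])
  qed
  show "partial i (\<lambda>x. cnj (f x)) = (\<lambda>x. cnj (partial i f x))" if "\<And>x. f differentiable (at x)"
    using part[OF that] .
qed

lemma smooth_differentiable: "smooth f \<Longrightarrow> f differentiable (at x)"
  using Ck.simps(2) unfolding smooth_def by blast

lemma smooth_continuous_on: "smooth f \<Longrightarrow> continuous_on UNIV f"
  using Ck.simps(1) unfolding smooth_def by blast

lemma smooth_partial: "smooth f \<Longrightarrow> smooth (partial i f)"
  using Ck.simps(2) unfolding smooth_def by blast

lemma smooth_lincomb: "smooth f \<Longrightarrow> smooth g \<Longrightarrow> smooth (\<lambda>x. a * f x + b * g x)"
  unfolding smooth_def using Ck_lincomb by blast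

lemma partial_lincomb:
  "smooth f \<Longrightarrow> smooth g \<Longrightarrow>
    partial i (\<lambda>x. a * f x + b * g x) = (\<lambda>x. a * partial i f x + b * partial i g x)"
  by (auto simp: partial_def frechet_derivative_lincomb smooth_differentiable)

lemma smooth_zero: "smooth (\<lambda>x. 0)"
proof -
  have "Ck k (\<lambda>x. 0)" for k
    by (induction k) (simp_all add: partial_def[abs_def])
  then show ?thesis by (simp add: smooth_def)
qed

text \<open>The complement of \<open>K\<close> is open, so near \<open>x\<close> the function
  coincides with zero. Partial derivatives thus inherit compact supports.\<close>

lemma partial_eq_0_outside:
  assumes "closed K" and "\<And>x. x \<notin> K \<Longrightarrow> f x = 0" and "x \<notin> K"
  shows "partial i f x = 0"
proof -
  have "((\<lambda>x. 0) has_derivative (\<lambda>v. 0)) (at x)" by simp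
  then have "(f has_derivative (\<lambda>v. 0)) (at x)"
    by (rule has_derivative_transform_within_open[of _ _ _ _ "- K"]) (use assms in auto)
  from frechet_derivative_at[OF this] show ?thesis by (metis partial_def)
qed

lemma integrable_lborel_compact_support:
  fixes f :: "R3 \<Rightarrow> 'b :: {banach, second_countable_topology}"
  assumes "continuous_on UNIV f" "compact K" "\<And>x. x \<notin> K \<Longrightarrow> f x = 0"
  shows "integrable lborel f"
proof -
  have "integrable lborel (\<lambda>x. indicator K x *\<^sub>R f x)"
    using assms by (intro borel_integrable_compact) (auto intro: continuous_on_subset)
  moreover have "(\<lambda>x. indicator K x *\<^sub>R f x) = f"
    using assms(3) by (auto simp: indicator_def)
  ultimately show ?thesis by simp
qed

text \<open>Difference quotients of \<open>f\<close> integrate to zero by translation invariance; their limit is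
  dominated because they are bounded by the supremum of the partial derivative.\<close>

lemma integral_partial_eq_0:
  assumes diff: "\<And>x. f differentiable (at x)" and cont: "continuous_on UNIV (partial i f)"
    and K: "compact K" "\<And>x. x \<notin> K \<Longrightarrow> f x = 0"
  shows "(LINT x|lborel. partial i f x) = 0"
proof -
  define e :: R3 where "e = axis i 1"
  have [simp]: "norm e = 1" by (simp add: e_def)
  define h :: "nat \<Rightarrow> real" where "h n = inverse (real (Suc n))" for n
  have h: "0 < h n" "h n \<le> 1" for n by (auto simp: h_def inverse_le_1_iff)
  have h0: "h \<longlonglongrightarrow> 0" unfolding h_def by (rule LIMSEQ_inverse_real_of_nat)
  have cf: "continuous_on UNIV f"
    using diff by (auto intro!: differentiable_imp_continuous_on simp: differentiable_on_def
        intro: differentiable_at_withinI)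
  have p0: "partial i f x = 0" if "x \<notin> K" for x
    using partial_eq_0_outside[of K f x] K that compact_imp_closed by blast
  have intf: "integrable lborel f" using integrable_lborel_compact_support[OF cf] K by blast
  \<comment> \<open>A bound on the whole space: compactness gives it on \<open>K\<close>, and off
    \<open>K\<close> the partial derivative vanishes.\<close>
  obtain B where B: "\<And>x. cmod (partial i f x) \<le> B" "0 \<le> B"
  proof -
    have "bounded (partial i f ` K)"
      by (intro compact_imp_bounded compact_continuous_image continuous_on_subset[OF cont] K) simp
    then obtain B where "\<And>x. x \<in> K \<Longrightarrow> cmod (partial i f x) \<le> B" "0 < B"
      by (auto simp: bounded_pos)
    then have "cmod (partial i f x) \<le> B" for x using p0[of x] by (cases "x \<in> K") auto
    with \<open>0 < B\<close> show thesis by (intro that[of B]) auto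
  qed
  obtain R where R: "\<And>x. x \<in> K \<Longrightarrow> norm x \<le> R"
    using compact_imp_bounded[OF K(1)] unfolding bounded_iff by metis
  define s where "s n x = (f (x + h n *\<^sub>R e) - f x) /\<^sub>R h n" for n x
  \<comment> \<open>The increments \<open>h n\<close> are at most 1, so every difference quotient
    vanishes outside the ball of radius \<open>R + 1\<close>. Inside it, the mean value inequality
    along the direction \<open>e\<close> gives the bound \<open>B\<close>.\<close>
  have s_bound: "norm (s n x) \<le> indicator (cball 0 (R + 1)) x *\<^sub>R B" for n x
  proof (cases "x \<in> cball 0 (R + 1)")
    case True
    have "norm (f (x + h n *\<^sub>R e) - f (x + 0 *\<^sub>R e)) \<le> B * norm (h n - 0)"
    proof (rule differentiable_bound[where S = UNIV and f = "\<lambda>t. f (x + t *\<^sub>R e)"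
            and f' = "\<lambda>t r. r *\<^sub>R partial i f (x + t *\<^sub>R e)"])
      fix t :: real
      let ?D = "frechet_derivative f (at (x + t *\<^sub>R e))"
      have "(f has_derivative ?D) (at (x + t *\<^sub>R e))"
        using diff frechet_derivative_works by blast
      moreover have "((\<lambda>t. x + t *\<^sub>R e) has_derivative (\<lambda>r. r *\<^sub>R e)) (at t)"
        by (auto intro!: derivative_eq_intros)
      ultimately have "((\<lambda>t. f (x + t *\<^sub>R e)) has_derivative (\<lambda>r. ?D (r *\<^sub>R e))) (at t)"
        by (rule has_derivative_compose[rotated])
      moreover have "?D (r *\<^sub>R e) = r *\<^sub>R partial i f (x + t *\<^sub>R e)" for r
        using linear_frechet_derivative[OF diff] by (simp add: partial_def e_def linear_scale)
      ultimately show "((\<lambda>t. f (x + t *\<^sub>R e)) has_derivative (\<lambda>r. r *\<^sub>R partial i f (x + t *\<^sub>R e))) (at t)"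
        by simp
      show "onorm (\<lambda>r. r *\<^sub>R partial i f (x + t *\<^sub>R e)) \<le> B"
        by (rule onorm_bound) (use B in \<open>auto simp: mult.commute[of B] intro!: mult_left_mono\<close>)
    qed auto
    moreover have "norm (s n x) = norm (f (x + h n *\<^sub>R e) - f x) / h n"
      using h[of n] by (simp add: s_def divide_inverse)
    ultimately show ?thesis using True h[of n] by (simp add: pos_divide_le_eq)
  next
    case False
    then have x: "norm x > R + 1" by simp
    have "norm (x + h n *\<^sub>R e) > R"
      using norm_triangle_ineq2[of x "- (h n *\<^sub>R e)"] x h[of n] by simp
    with x R[of x] R[of "x + h n *\<^sub>R e"] have "x \<notin> K" "x + h n *\<^sub>R e \<notin> K" by auto
    with K(2) B(2) show ?thesis by (simp add: s_def)
  qed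
  have s_int: "(LINT x|lborel. s n x) = 0" for n
  proof -
    have "integrable lborel (\<lambda>x. f (h n *\<^sub>R e + x))"
      and shift: "(LINT x|lborel. f (h n *\<^sub>R e + x)) = (LINT x|lborel. f x)"
    proof -
      have m: "f \<in> borel_measurable borel" using cf by (rule borel_measurable_continuous_onI)
      have "integrable (distr lborel borel ((+) (h n *\<^sub>R e))) f"
        using intf by (simp add: lborel_distr_plus)
      then show "integrable lborel (\<lambda>x. f (h n *\<^sub>R e + x))"
        using m by (simp add: integrable_distr_eq)
      have "(LINT x|lborel. f x) = (LINT x|distr lborel borel ((+) (h n *\<^sub>R e)). f x)"
        by (simp add: lborel_distr_plus)
      also have "\<dots> = (LINT x|lborel. f (h n *\<^sub>R e + x))"
        using m by (simp add: integral_distr)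
      finally show "(LINT x|lborel. f (h n *\<^sub>R e + x)) = (LINT x|lborel. f x)" ..
    qed
    then show ?thesis using intf by (simp add: s_def add.commute)
  qed
  have s_lim: "(\<lambda>n. s n x) \<longlonglongrightarrow> partial i f x" for x
  proof -
    let ?D = "frechet_derivative f (at x)"
    have D: "(f has_derivative ?D) (at x)" using diff frechet_derivative_works by blast
    \<comment> \<open>The limit defining the derivative is taken along the nonzero vectors
      \<open>h n *\<^sub>R e\<close>, where the error quotient is exactly the distance from
      \<open>s n x\<close> to the partial derivative.\<close>
    have "((\<lambda>y. norm (f (x + y) - f x - ?D y) / norm y) \<longlongrightarrow> 0) (at 0)"
      using D by (simp add: has_derivative_at)
    moreover have "h n *\<^sub>R e \<noteq> 0" for n
      using h(1)[of n] by (simp add: e_def axis_eq_0_iff)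
    then have "filterlim (\<lambda>n. h n *\<^sub>R e) (at 0) sequentially"
      using tendsto_scaleR[OF h0 tendsto_const[of e]] by (simp add: filterlim_at)
    ultimately have "(\<lambda>n. norm (f (x + h n *\<^sub>R e) - f x - ?D (h n *\<^sub>R e)) / norm (h n *\<^sub>R e)) \<longlonglongrightarrow> 0"
      by (rule filterlim_compose)
    moreover have "norm (f (x + h n *\<^sub>R e) - f x - ?D (h n *\<^sub>R e)) / norm (h n *\<^sub>R e)
        = norm (s n x - partial i f x)" for n
    proof -
      have "s n x - partial i f x = (f (x + h n *\<^sub>R e) - f x - ?D (h n *\<^sub>R e)) /\<^sub>R h n"
        using h[of n] linear_frechet_derivative[OF diff]
        by (simp add: s_def partial_def e_def linear_scale scaleR_diff_right)
      then show ?thesis using h[of n] by (simp add: divide_inverse)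
    qed
    ultimately show ?thesis by (simp add: tendsto_norm_zero_iff LIM_zero_iff)
  qed
  have "(\<lambda>n. LINT x|lborel. s n x) \<longlonglongrightarrow> (LINT x|lborel. partial i f x)"
  proof (rule integral_dominated_convergence)
    show "partial i f \<in> borel_measurable lborel"
      using borel_measurable_continuous_onI[OF cont] by simp
    have "continuous_on UNIV (s n)" for n
      unfolding s_def by (intro continuous_intros continuous_on_compose2[OF cf]) auto
    then show "s n \<in> borel_measurable lborel" for n
      using borel_measurable_continuous_onI[of "s n"] by simp
    show "integrable lborel (\<lambda>x. indicator (cball 0 (R + 1)) x *\<^sub>R B)"
      by (intro borel_integrable_compact) auto
  qed (use s_lim s_bound in auto)
  then show ?thesis by (simp add: s_int LIMSEQ_const_iff)
qed

section \<open>Measurability, and transfer of integrals from \<open>lborel\<close> to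
  \<open>vol\<close>\<close>

lemma continuous_measurable_vol:
  assumes "continuous_on UNIV f"
  shows "f \<in> borel_measurable (vol \<Omega>)"
  using borel_measurable_continuous_onI[OF assms]
  by (intro measurable_restrict_space1 measurable_completion) simp

text \<open>The sigma-algebra of a \<open>measure_of\<close> is determined by its generators, and
  the Borel sets already form one. This makes continuous functions measurable for the surface
  measure.\<close>

lemma sets_hausdorff2: "sets hausdorff2 = sets borel"
  unfolding hausdorff2_def using sets.sigma_sets_eq[of "borel :: R3 measure"] by simp

lemma continuous_measurable_surf:
  assumes "continuous_on UNIV f"
  shows "f \<in> borel_measurable (surf \<Omega>)"
proof -
  have "f \<in> borel_measurable hausdorff2"
    using borel_measurable_continuous_onI[OF assms] measurable_cong_sets[OF sets_hausdorff2 refl] by blast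
  then show ?thesis unfolding surf_def by (rule measurable_restrict_space1)
qed

lemma integrable_vol_if_lborel:
  fixes f :: "R3 \<Rightarrow> 'b :: {banach, second_countable_topology}"
  assumes "open \<Omega>" "integrable lborel f"
  shows "integrable (vol \<Omega>) f"
proof -
  have "integrable lebesgue f"
    using assms integrable_completion[of f lborel] borel_measurable_integrable by blast
  then have "integrable lebesgue (\<lambda>x. indicator \<Omega> x *\<^sub>R f x)"
    using assms by (intro integrable_mult_indicator) auto
  then show ?thesis using assms by (subst integrable_restrict_space) auto
qed

text \<open>Vanishing off \<open>\<Omega>\<close> absorbs the indicator of the restriction, and
  completing the measure leaves the integral of a Borel function unchanged.\<close>

lemma integral_vol_eq_lborel:
  fixes f :: "R3 \<Rightarrow> 'b :: {banach, second_countable_topology}"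
  assumes "open \<Omega>" "integrable lborel f" "\<And>x. x \<notin> \<Omega> \<Longrightarrow> f x = 0"
  shows "(LINT x|vol \<Omega>. f x) = (LINT x|lborel. f x)"
proof -
  have "(\<lambda>x. indicator \<Omega> x *\<^sub>R f x) = f" using assms(3) by (auto simp: indicator_def)
  then have "(LINT x|vol \<Omega>. f x) = (LINT x|lebesgue. f x)"
    using assms by (subst integral_restrict_space) auto
  also have "\<dots> = (LINT x|lborel. f x)"
    using assms borel_measurable_integrable by (intro integral_completion) blast
  finally show ?thesis .
qed

lemma L2_vol_compact_support:
  assumes "open \<Omega>" "continuous_on UNIV f" "compact K" "\<And>x. x \<notin> K \<Longrightarrow> f x = 0"
  shows "f \<in> L2 (vol \<Omega>)"
proof -
  have "integrable lborel (\<lambda>x. (cmod (f x))\<^sup>2)"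
    by (rule integrable_lborel_compact_support[of _ K]) (use assms in \<open>auto intro!: continuous_intros\<close>)
  then show ?thesis
    using assms by (simp add: L2_def continuous_measurable_vol integrable_vol_if_lborel)
qed

section \<open>Test functions\<close>

lemma test_funE:
  assumes "\<phi> \<in> test_fun \<Omega>"
  obtains K where "smooth \<phi>" "compact K" "K \<subseteq> \<Omega>" "\<And>x. x \<notin> K \<Longrightarrow> \<phi> x = 0"
    "\<And>i x. x \<notin> K \<Longrightarrow> partial i \<phi> x = 0"
  using assms partial_eq_0_outside compact_imp_closed unfolding test_fun_def by blast

lemma test_fun_cnj: "\<phi> \<in> test_fun \<Omega> \<Longrightarrow> (\<lambda>x. cnj (\<phi> x)) \<in> test_fun \<Omega>"
  unfolding test_fun_def smooth_def by (auto simp: Ck_cnj)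

lemma test_fun_L2:
  assumes "open \<Omega>" "\<phi> \<in> test_fun \<Omega>"
  shows "\<phi> \<in> L2 (vol \<Omega>)" "partial i \<phi> \<in> L2 (vol \<Omega>)"
proof -
  obtain K where K: "smooth \<phi>" "compact K" "\<And>x. x \<notin> K \<Longrightarrow> \<phi> x = 0" "\<And>x. x \<notin> K \<Longrightarrow> partial i \<phi> x = 0"
    using test_funE[OF assms(2)] by metis
  show "\<phi> \<in> L2 (vol \<Omega>)"
    by (rule L2_vol_compact_support[OF assms(1) smooth_continuous_on[OF K(1)] K(2,3)])
  show "partial i \<phi> \<in> L2 (vol \<Omega>)"
    by (rule L2_vol_compact_support[OF assms(1) smooth_continuous_on[OF smooth_partial[OF K(1)]] K(2,4)])
qed

text \<open>The product rule, combined with \<open>integral_partial_eq_0\<close> for the product,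
  which vanishes off the compact set \<open>K\<close>.\<close>

lemma test_fun_integration_by_parts:
  assumes "open \<Omega>" and \<phi>: "\<phi> \<in> test_fun \<Omega>" and \<psi>: "\<psi> \<in> test_fun \<Omega>"
  shows "(LINT x|vol \<Omega>. \<phi> x * partial i \<psi> x) = - (LINT x|vol \<Omega>. partial i \<phi> x * \<psi> x)"
proof -
  obtain K where K: "compact K" "K \<subseteq> \<Omega>" and \<phi>0: "\<And>x. x \<notin> K \<Longrightarrow> \<phi> x = 0"
    "\<And>x. x \<notin> K \<Longrightarrow> partial i \<phi> x = 0" and s\<phi>: "smooth \<phi>"
    using test_funE[OF \<phi>] by metis
  have s\<psi>: "smooth \<psi>" using \<psi> by (simp add: test_fun_def)
  note d = smooth_differentiable[OF s\<phi>] smooth_differentiable[OF s\<psi>]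
  note c = s\<phi>[THEN smooth_continuous_on] s\<psi>[THEN smooth_continuous_on]
    s\<phi>[THEN smooth_partial, THEN smooth_continuous_on] s\<psi>[THEN smooth_partial, THEN smooth_continuous_on]
  have prod: "partial i (\<lambda>x. \<phi> x * \<psi> x) = (\<lambda>x. \<phi> x * partial i \<psi> x + partial i \<phi> x * \<psi> x)"
  proof
    fix x
    have "((\<lambda>x. \<phi> x * \<psi> x) has_derivative
        (\<lambda>v. \<phi> x * frechet_derivative \<psi> (at x) v + frechet_derivative \<phi> (at x) v * \<psi> x)) (at x)"
      by (intro has_derivative_mult d[unfolded frechet_derivative_works])
    from frechet_derivative_at[OF this]
    show "partial i (\<lambda>x. \<phi> x * \<psi> x) x = \<phi> x * partial i \<psi> x + partial i \<phi> x * \<psi> x"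
      unfolding partial_def by metis
  qed
  have int: "integrable lborel (\<lambda>x. \<phi> x * partial i \<psi> x)" "integrable lborel (\<lambda>x. partial i \<phi> x * \<psi> x)"
    by (rule integrable_lborel_compact_support[of _ K]; use K \<phi>0 in \<open>auto intro!: continuous_intros c\<close>)+
  have "(LINT x|lborel. partial i (\<lambda>x. \<phi> x * \<psi> x) x) = 0"
  proof (rule integral_partial_eq_0[of _ _ K])
    show "continuous_on UNIV (partial i (\<lambda>x. \<phi> x * \<psi> x))"
      unfolding prod by (intro continuous_intros c)
  qed (use d \<phi>0 K in \<open>auto intro!: derivative_intros\<close>)
  then have "(LINT x|lborel. \<phi> x * partial i \<psi> x) + (LINT x|lborel. partial i \<phi> x * \<psi> x) = 0"
    using int by (simp add: prod)
  \<comment> \<open>Both integrands vanish off \<open>\<Omega>\<close>, so the identity over the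
    whole space is one over \<open>\<Omega>\<close>.\<close>
  moreover have "\<phi> x = 0" "partial i \<phi> x = 0" if "x \<notin> \<Omega>" for x
    using that K \<phi>0 by auto
  ultimately show ?thesis
    using int by (simp add: integral_vol_eq_lborel[OF assms(1)] eq_neg_iff_add_eq_0)
qed

subsection \<open>Gradient and trace\<close>

text \<open>Integration by parts shows that the classical gradient satisfies the weak formula.
  Together with the zero trace this puts test functions into the domain of
  \<open>triple_op\<close>.\<close>

lemma gradient_test_fun:
  assumes "open \<Omega>" "\<phi> \<in> test_fun \<Omega>"
  shows "(\<phi>, \<lambda>x. \<chi> i. partial i \<phi> x) \<in> gradient \<Omega>"
  using assms by (auto simp: gradient_def L2v_def test_fun_L2 test_fun_integration_by_parts)

text \<open>The constant sequence \<open>\<phi>\<close> is its own smooth approximation. An open set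
  does not meet its frontier, so \<open>\<phi>\<close> is zero on the space of \<open>surf\<close>;
  elsewhere it may differ from the zero function, hence the form of
  \<open>L2_lim_const\<close>.\<close>

lemma trace_map_test_fun:
  assumes "open \<Omega>" "\<phi> \<in> test_fun \<Omega>"
  shows "(\<phi>, \<lambda>x. 0) \<in> trace_map \<Omega>"
proof -
  obtain K where K: "smooth \<phi>" "K \<subseteq> \<Omega>" "\<And>x. x \<notin> K \<Longrightarrow> \<phi> x = 0"
    using test_funE[OF assms(2)] by metis
  have "\<phi> x = 0" if "x \<in> space (surf \<Omega>)" for x
  proof -
    have "x \<in> frontier \<Omega>" using that by (simp add: surf_def space_restrict_space)
    then have "x \<notin> \<Omega>" using frontier_disjoint_eq assms(1) by auto
    with K show ?thesis by auto
  qed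
  then show ?thesis
    unfolding trace_map_def using gradient_test_fun[OF assms] K(1)
    by (auto intro!: exI[of _ "\<lambda>x. \<chi> i. partial i \<phi> x"] exI[of _ "\<lambda>k. \<phi>"] L2_lim_const)
qed

lemma grad_bd_zero: "(\<lambda>x. 0, \<lambda>x. 0) \<in> grad_bd \<Omega> \<tau>"
  unfolding grad_bd_def
  by (auto intro!: exI[of _ "\<lambda>k x. 0"] L2_lim_const smooth_zero)

lemma gradient_lincomb:
  assumes "open \<Omega>" and uw: "(u, w) \<in> gradient \<Omega>" "(u', w') \<in> gradient \<Omega>"
  shows "(\<lambda>x. a * u x + b * u' x, \<lambda>x. a *s w x + b *s w' x) \<in> gradient \<Omega>"
proof -
  have "(LINT x|vol \<Omega>. (a * u x + b * u' x) * partial i \<phi> x)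
      = - (LINT x|vol \<Omega>. (a *s w x + b *s w' x) $ i * \<phi> x)" if \<phi>: "\<phi> \<in> test_fun \<Omega>" for \<phi> i
  proof -
    note T = test_fun_L2[OF assms(1) \<phi>]
    have I: "integrable (vol \<Omega>) (\<lambda>x. u x * partial i \<phi> x)" "integrable (vol \<Omega>) (\<lambda>x. u' x * partial i \<phi> x)"
      "integrable (vol \<Omega>) (\<lambda>x. w x $ i * \<phi> x)" "integrable (vol \<Omega>) (\<lambda>x. w' x $ i * \<phi> x)"
      using uw T by (auto simp: gradient_def intro!: L2_times_integrable L2v_component)
    have "(LINT x|vol \<Omega>. (a * u x + b * u' x) * partial i \<phi> x)
        = (LINT x|vol \<Omega>. a * (u x * partial i \<phi> x) + b * (u' x * partial i \<phi> x))"
      by (simp add: algebra_simps)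
    also have "\<dots> = - (LINT x|vol \<Omega>. a * (w x $ i * \<phi> x) + b * (w' x $ i * \<phi> x))"
      using I uw \<phi> by (simp add: gradient_def)
    also have "\<dots> = - (LINT x|vol \<Omega>. (a *s w x + b *s w' x) $ i * \<phi> x)"
      by (simp add: algebra_simps)
    finally show ?thesis .
  qed
  with uw show ?thesis by (simp add: gradient_def L2_lincomb L2v_lincomb)
qed

text \<open>The two approximating sequences are combined with the same coefficients, and
  \<open>L2_lim_lincomb\<close> carries over the limits of the functions, of their partial
  derivatives and of their boundary values.\<close>

lemma trace_map_lincomb:
  assumes "open \<Omega>" and "(u, g) \<in> trace_map \<Omega>" "(u', g') \<in> trace_map \<Omega>"
  shows "(\<lambda>x. a * u x + b * u' x, \<lambda>x. a * g x + b * g' x) \<in> trace_map \<Omega>"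
proof -
  obtain w \<phi> where 1: "(u, w) \<in> gradient \<Omega>" "\<And>k. smooth (\<phi> k)" "L2_lim (vol \<Omega>) \<phi> u"
    "\<And>i. L2_lim (vol \<Omega>) (\<lambda>k. partial i (\<phi> k)) (\<lambda>x. w x $ i)" "L2_lim (surf \<Omega>) \<phi> g" "g \<in> L2 (surf \<Omega>)"
    using assms(2) by (auto simp: trace_map_def)
  obtain w' \<phi>' where 2: "(u', w') \<in> gradient \<Omega>" "\<And>k. smooth (\<phi>' k)" "L2_lim (vol \<Omega>) \<phi>' u'"
    "\<And>i. L2_lim (vol \<Omega>) (\<lambda>k. partial i (\<phi>' k)) (\<lambda>x. w' x $ i)" "L2_lim (surf \<Omega>) \<phi>' g'" "g' \<in> L2 (surf \<Omega>)"
    using assms(3) by (auto simp: trace_map_def)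
  have m: "u \<in> borel_measurable (vol \<Omega>)" "u' \<in> borel_measurable (vol \<Omega>)"
    "(\<lambda>x. w x $ i) \<in> borel_measurable (vol \<Omega>)" "(\<lambda>x. w' x $ i) \<in> borel_measurable (vol \<Omega>)" for i
    using 1(1) 2(1) by (auto simp: gradient_def intro!: L2_measurable L2v_component)
  have s: "\<phi> k \<in> borel_measurable (vol \<Omega>)" "\<phi>' k \<in> borel_measurable (vol \<Omega>)"
    "partial i (\<phi> k) \<in> borel_measurable (vol \<Omega>)" "partial i (\<phi>' k) \<in> borel_measurable (vol \<Omega>)"
    "\<phi> k \<in> borel_measurable (surf \<Omega>)" "\<phi>' k \<in> borel_measurable (surf \<Omega>)" for i k
    using 1(2) 2(2)
    by (auto intro!: continuous_measurable_vol continuous_measurable_surf smooth_continuous_on smooth_partial)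
  show ?thesis
    unfolding trace_map_def
  proof (clarify, intro conjI exI allI)
    show "(\<lambda>x. a * u x + b * u' x, \<lambda>x. a *s w x + b *s w' x) \<in> gradient \<Omega>"
      using gradient_lincomb[OF assms(1) 1(1) 2(1)] .
    show "smooth (\<lambda>x. a * \<phi> k x + b * \<phi>' k x)" for k using 1 2 by (simp add: smooth_lincomb)
    show "L2_lim (vol \<Omega>) (\<lambda>k x. a * \<phi> k x + b * \<phi>' k x) (\<lambda>x. a * u x + b * u' x)"
      by (intro L2_lim_lincomb m s 1 2)
    show "L2_lim (surf \<Omega>) (\<lambda>k x. a * \<phi> k x + b * \<phi>' k x) (\<lambda>x. a * g x + b * g' x)"
      by (intro L2_lim_lincomb m s 1 2 L2_measurable)
    show "L2_lim (vol \<Omega>) (\<lambda>k. partial i (\<lambda>x. a * \<phi> k x + b * \<phi>' k x))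
        (\<lambda>x. (a *s w x + b *s w' x) $ i)" for i
      using L2_lim_lincomb[OF s(3) s(4) m(3) m(4) 1(4) 2(4)] 1(2) 2(2)
      by (simp add: partial_lincomb)
    show "(\<lambda>x. a * g x + b * g' x) \<in> L2 (surf \<Omega>)" using 1 2 by (simp add: L2_lincomb)
  qed
qed

section \<open>Traces, and functionals determined on them\<close>

lemma H_halfE:
  assumes "g \<in> H_half \<Omega>"
  obtains \<psi> w where "(\<psi>, w) \<in> gradient \<Omega>" "(\<psi>, g) \<in> trace_map \<Omega>"
  using assms unfolding H_half_def trace_map_def by blast

lemma H_half_lincomb:
  assumes "open \<Omega>" "g \<in> H_half \<Omega>" "h \<in> H_half \<Omega>"
  shows "(\<lambda>x. a * g x + b * h x) \<in> H_half \<Omega>"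
  using assms trace_map_lincomb[OF assms(1)] unfolding H_half_def by blast

text \<open>All conditions evaluate the functional at traces or at linear combinations of traces,
  which are traces again. Its values off \<open>H_half\<close> may therefore be redefined
  freely.\<close>

lemma is_normal_trace_cong:
  assumes "open \<Omega>" and F: "is_normal_trace \<Omega> v F" and eq: "\<And>g. g \<in> H_half \<Omega> \<Longrightarrow> F' g = F g"
  shows "is_normal_trace \<Omega> v F'"
proof -
  have trace: "F' g = F g" if "(\<psi>, g) \<in> trace_map \<Omega>" for \<psi> g
    using that eq unfolding H_half_def by blast
  have "F' \<in> H_half_dual \<Omega>"
    using F by (simp add: is_normal_trace_def H_half_dual_def eq H_half_lincomb[OF assms(1)] trace cong: conj_cong imp_cong)
  with F show ?thesis by (simp add: is_normal_trace_def trace cong: conj_cong imp_cong)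
qed

subsection \<open>The normal trace and the adjoint\<close>

text \<open>The value at \<open>g\<close> is read off from any \<open>\<psi>\<close> with trace
  \<open>g\<close>. By \<open>ker\<close> it does not depend on \<open>\<psi>\<close>, and linearity
  and boundedness are inherited from the right-hand side.\<close>

lemma normal_trace_exists:
  assumes "open \<Omega>" and vd: "(v, d) \<in> divergence \<Omega>"
    and ker: "\<And>\<psi> w. (\<psi>, w) \<in> gradient \<Omega> \<Longrightarrow> (\<psi>, \<lambda>x. 0) \<in> trace_map \<Omega> \<Longrightarrow>
      ip (vol \<Omega>) d \<psi> + ipv (vol \<Omega>) v w = 0"
  obtains F where "is_normal_trace \<Omega> v F"
    "\<And>\<psi> w g. (\<psi>, w) \<in> gradient \<Omega> \<Longrightarrow> (\<psi>, g) \<in> trace_map \<Omega> \<Longrightarrow>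
      F g = ip (vol \<Omega>) d \<psi> + ipv (vol \<Omega>) v w"
proof -
  define l where "l \<psi> w = ip (vol \<Omega>) d \<psi> + ipv (vol \<Omega>) v w" for \<psi> w
  \<comment> \<open>For each trace \<open>g\<close> the choice ranges over the values attained by
    its extensions \<open>\<psi>\<close>, later shown to coincide; off \<open>H_half\<close> the
    value is unspecified.\<close>
  define F where "F g = (SOME c. \<exists>\<psi> w. (\<psi>, w) \<in> gradient \<Omega> \<and> (\<psi>, g) \<in> trace_map \<Omega> \<and> c = l \<psi> w)" for g
  have v: "v \<in> L2v (vol \<Omega>)" and d: "d \<in> L2 (vol \<Omega>)" using vd by (auto simp: divergence_def)
  have grad: "\<psi> \<in> L2 (vol \<Omega>)" "w \<in> L2v (vol \<Omega>)" if "(\<psi>, w) \<in> gradient \<Omega>" for \<psi> w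
    using that by (auto simp: gradient_def)
  have l_lincomb: "l (\<lambda>x. a * \<psi> x + b * \<psi>' x) (\<lambda>x. a *s w x + b *s w' x) = a * l \<psi> w + b * l \<psi>' w'"
    if "(\<psi>, w) \<in> gradient \<Omega>" "(\<psi>', w') \<in> gradient \<Omega>" for a b \<psi> \<psi>' w w'
    using grad[OF that(1)] grad[OF that(2)] v d
    by (simp add: l_def ip_lincomb ipv_lincomb algebra_simps)
  have unique: "l \<psi> w = l \<psi>' w'"
    if 1: "(\<psi>, w) \<in> gradient \<Omega>" "(\<psi>, g) \<in> trace_map \<Omega>"
      and 2: "(\<psi>', w') \<in> gradient \<Omega>" "(\<psi>', g) \<in> trace_map \<Omega>" for \<psi> w \<psi>' w' g
  proof -
    \<comment> \<open>Coefficients \<open>1\<close> and \<open>-1\<close> bring the difference of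
      two extensions into the form of the linear combination lemmas; its trace is zero, so
      \<open>ker\<close> applies.\<close>
    have "l (\<lambda>x. 1 * \<psi> x + -1 * \<psi>' x) (\<lambda>x. 1 *s w x + -1 *s w' x) = 0"
      unfolding l_def
    proof (rule ker)
      show "(\<lambda>x. 1 * \<psi> x + -1 * \<psi>' x, \<lambda>x. 1 *s w x + -1 *s w' x) \<in> gradient \<Omega>"
        by (rule gradient_lincomb[OF assms(1) 1(1) 2(1)])
      show "(\<lambda>x. 1 * \<psi> x + -1 * \<psi>' x, \<lambda>x. 0) \<in> trace_map \<Omega>"
        using trace_map_lincomb[OF assms(1) 1(2) 2(2), of 1 "-1"] by simp
    qed
    then show ?thesis by (simp only: l_lincomb[OF 1(1) 2(1)]) simp
  qed
  have F: "F g = l \<psi> w" if "(\<psi>, w) \<in> gradient \<Omega>" "(\<psi>, g) \<in> trace_map \<Omega>" for \<psi> w g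
    unfolding F_def by (rule some_equality) (use that unique in blast)+
  have lin: "F (\<lambda>x. a * g x + b * h x) = a * F g + b * F h"
    if g: "g \<in> H_half \<Omega>" and h: "h \<in> H_half \<Omega>" for g h a b
  proof -
    obtain \<psi> w where 1: "(\<psi>, w) \<in> gradient \<Omega>" "(\<psi>, g) \<in> trace_map \<Omega>" using H_halfE[OF g] .
    obtain \<psi>' w' where 2: "(\<psi>', w') \<in> gradient \<Omega>" "(\<psi>', h) \<in> trace_map \<Omega>" using H_halfE[OF h] .
    show ?thesis
      using F[OF gradient_lincomb trace_map_lincomb, OF assms(1) 1(1) 2(1) assms(1) 1(2) 2(2)]
      by (simp add: F[OF 1] F[OF 2] l_lincomb[OF 1(1) 2(1)])
  qed
  define nd where "nd = sqrt (Re (ip (vol \<Omega>) d d))"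
  define nv where "nv i = sqrt (Re (ip (vol \<Omega>) (\<lambda>x. v x $ i) (\<lambda>x. v x $ i)))" for i
  \<comment> \<open>Cauchy-Schwarz is applied to \<open>d\<close> and to each component of
    \<open>v\<close> separately, so the constant is a sum of norms; the norms of
    \<open>\<psi>\<close> and of each component of \<open>w\<close> are at most
    \<open>H1_norm\<close>.\<close>
  have bound: "cmod (F g) \<le> (nd + (\<Sum>i\<in>UNIV. nv i)) * H1_norm \<Omega> \<psi> w"
    if \<psi>w: "(\<psi>, w) \<in> gradient \<Omega>" "(\<psi>, g) \<in> trace_map \<Omega>" for \<psi> w g
  proof -
    note L = grad[OF \<psi>w(1)]
    have S: "0 \<le> Re (ipv (vol \<Omega>) w w)" by (simp add: ipv_def sum_nonneg Re_ip_self_nonneg)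
    have "cmod (ip (vol \<Omega>) d \<psi>) \<le> nd * sqrt (Re (ip (vol \<Omega>) \<psi> \<psi>))"
      unfolding nd_def by (rule ip_Cauchy_Schwarz[OF d L(1)])
    also have "\<dots> \<le> nd * H1_norm \<Omega> \<psi> w"
      unfolding H1_norm_def using S by (intro mult_left_mono) (auto simp: nd_def Re_ip_self_nonneg)
    finally have A: "cmod (ip (vol \<Omega>) d \<psi>) \<le> nd * H1_norm \<Omega> \<psi> w" .
    have B: "cmod (ip (vol \<Omega>) (\<lambda>x. v x $ i) (\<lambda>x. w x $ i)) \<le> nv i * H1_norm \<Omega> \<psi> w" for i
    proof -
      let ?r = "Re (ip (vol \<Omega>) (\<lambda>x. w x $ i) (\<lambda>x. w x $ i))"
      have "cmod (ip (vol \<Omega>) (\<lambda>x. v x $ i) (\<lambda>x. w x $ i)) \<le> nv i * sqrt ?r"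
        unfolding nv_def by (rule ip_Cauchy_Schwarz[OF L2v_component[OF v] L2v_component[OF L(2)]])
      also have "?r \<le> Re (ipv (vol \<Omega>) w w)"
        unfolding ipv_def Re_sum by (rule member_le_sum) (auto simp: Re_ip_self_nonneg)
      then have "nv i * sqrt ?r \<le> nv i * H1_norm \<Omega> \<psi> w"
        unfolding H1_norm_def
        using Re_ip_self_nonneg[of "vol \<Omega>" \<psi>]
        by (intro mult_left_mono real_sqrt_le_mono)
          (auto simp: nv_def Re_ip_self_nonneg intro: add_increasing)
      finally show ?thesis .
    qed
    have "cmod (F g) \<le> cmod (ip (vol \<Omega>) d \<psi>)
        + (\<Sum>i\<in>UNIV. cmod (ip (vol \<Omega>) (\<lambda>x. v x $ i) (\<lambda>x. w x $ i)))"
      unfolding F[OF \<psi>w] l_def ipv_def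
      by (rule order_trans[OF norm_triangle_ineq add_left_mono[OF norm_sum]])
    also have "\<dots> \<le> nd * H1_norm \<Omega> \<psi> w + (\<Sum>i\<in>UNIV. nv i * H1_norm \<Omega> \<psi> w)"
      by (intro add_mono A sum_mono B)
    finally show ?thesis by (simp add: algebra_simps sum_distrib_right)
  qed
  have "is_normal_trace \<Omega> v F"
    unfolding is_normal_trace_def H_half_dual_def using lin bound vd F unfolding l_def by blast
  then show thesis using that F unfolding l_def by blast
qed

section \<open>The adjoint condition and the boundary condition\<close>

lemma mem_triple_adj:
  "((v, \<eta>1, \<eta>2), f) \<in> triple_adj \<Omega> \<tau> \<longleftrightarrow>
    v \<in> L2v (vol \<Omega>) \<and> \<eta>1 \<in> L2 (surf \<Omega>) \<and> \<eta>2 \<in> L2v (surf \<Omega>) \<and> f \<in> L2 (vol \<Omega>) \<and>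
    (\<forall>u w g h. (u, w) \<in> gradient \<Omega> \<longrightarrow> (u, g) \<in> trace_map \<Omega> \<longrightarrow> (g, h) \<in> grad_bd \<Omega> \<tau> \<longrightarrow>
      ipv (vol \<Omega>) v w + ip (surf \<Omega>) \<eta>1 g + ipv (surf \<Omega>) \<eta>2 h = ip (vol \<Omega>) f u)"
  by (auto simp: triple_adj_def adjoint_def triple_op_def ip_sum_def)

text \<open>A test function has zero trace, and zero is paired with zero in \<open>grad_bd\<close>.
  Both boundary terms drop out, which leaves the distributional formula up to conjugation.\<close>

lemma triple_adj_divergence:
  assumes "open \<Omega>" and adj: "((v, \<eta>1, \<eta>2), f) \<in> triple_adj \<Omega> \<tau>"
  shows "(v, \<lambda>x. - f x) \<in> divergence \<Omega>"
proof -
  have L: "v \<in> L2v (vol \<Omega>)" "f \<in> L2 (vol \<Omega>)" using adj by (auto simp: mem_triple_adj)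
  have "(\<Sum>i\<in>UNIV. LINT x|vol \<Omega>. v x $ i * partial i \<phi> x) = - (LINT x|vol \<Omega>. - f x * \<phi> x)"
    if \<phi>: "\<phi> \<in> test_fun \<Omega>" for \<phi>
  proof -
    \<comment> \<open>\<open>ip\<close> and \<open>ipv\<close> conjugate \<open>f\<close> and
      \<open>v\<close>. Conjugating the adjoint identity for \<open>?\<psi>\<close> restores
      \<open>f\<close> and \<open>v\<close> and turns \<open>?\<psi>\<close> back into
      \<open>\<phi>\<close>.\<close>
    let ?\<psi> = "\<lambda>x. cnj (\<phi> x)"
    have \<psi>: "?\<psi> \<in> test_fun \<Omega>" using \<phi> by (rule test_fun_cnj)
    have p: "partial i ?\<psi> = (\<lambda>x. cnj (partial i \<phi> x))" for i
      using \<phi> by (intro partial_cnj smooth_differentiable) (simp add: test_fun_def)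
    have "ipv (vol \<Omega>) v (\<lambda>x. \<chi> i. partial i ?\<psi> x) = ip (vol \<Omega>) f ?\<psi>"
      using adj gradient_test_fun[OF assms(1) \<psi>] trace_map_test_fun[OF assms(1) \<psi>] grad_bd_zero[of \<Omega> \<tau>]
      unfolding mem_triple_adj by fastforce
    then have "cnj (ipv (vol \<Omega>) v (\<lambda>x. \<chi> i. partial i ?\<psi> x)) = cnj (ip (vol \<Omega>) f ?\<psi>)" by simp
    then show ?thesis
      by (simp only: ipv_def ip_def p cnj_sum Bochner_Integration.integral_cnj[symmetric]
          complex_cnj_mult complex_cnj_cnj vec_lambda_beta) simp
  qed
  moreover have "(\<lambda>x. - f x) \<in> L2 (vol \<Omega>)" using L2_lincomb[OF L(2) L(2), of "-1" 0] by simp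
  ultimately show ?thesis using L by (simp add: divergence_def)
qed

lemma ip_uminus_left: "ip M (\<lambda>x. - f x) g = - ip M f g"
  by (simp add: ip_def)

lemma app_mem: "x \<in> Domain A \<Longrightarrow> (x, app A x) \<in> A"
  unfolding app_def by (auto intro: someI)

text \<open>Off \<open>H_half\<close> membership in \<open>H_half_dual\<close> imposes nothing, so there the functional is
  simply chosen to satisfy the boundary condition.\<close>

lemma triple_adj_normal_trace:
  assumes "open \<Omega>" and adj: "((v, \<eta>1, \<eta>2), f) \<in> triple_adj \<Omega> \<tau>"
  obtains nv where "is_normal_trace \<Omega> v nv"
    "\<And>g. g \<in> H1_bd \<Omega> \<tau> \<Longrightarrow> nv g + ip (surf \<Omega>) \<eta>1 g + grad_bd_diamond \<Omega> \<tau> \<eta>2 g = 0"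
proof -
  have cond: "ipv (vol \<Omega>) v w + ip (surf \<Omega>) \<eta>1 g + ipv (surf \<Omega>) \<eta>2 h = ip (vol \<Omega>) f u"
    if "(u, w) \<in> gradient \<Omega>" "(u, g) \<in> trace_map \<Omega>" "(g, h) \<in> grad_bd \<Omega> \<tau>" for u w g h
    using that adj unfolding mem_triple_adj by blast
  \<comment> \<open>For zero trace the pair of zero functions in \<open>grad_bd\<close> is
    admissible, and the adjoint condition becomes the kernel hypothesis of
    \<open>normal_trace_exists\<close> with \<open>- f\<close> as divergence.\<close>
  have "ip (vol \<Omega>) (\<lambda>x. - f x) \<psi> + ipv (vol \<Omega>) v w = 0"
    if "(\<psi>, w) \<in> gradient \<Omega>" "(\<psi>, \<lambda>x. 0) \<in> trace_map \<Omega>" for \<psi> w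
    using cond[OF that grad_bd_zero] by (simp add: ip_uminus_left)
  from normal_trace_exists[OF assms(1) triple_adj_divergence[OF assms] this]
  obtain F where F: "is_normal_trace \<Omega> v F" and
    Feq: "\<And>\<psi> w g. (\<psi>, w) \<in> gradient \<Omega> \<Longrightarrow> (\<psi>, g) \<in> trace_map \<Omega> \<Longrightarrow>
      F g = ip (vol \<Omega>) (\<lambda>x. - f x) \<psi> + ipv (vol \<Omega>) v w"
    by metis
  define nv where "nv g = (if g \<in> H_half \<Omega> then F g
      else - (ip (surf \<Omega>) \<eta>1 g + grad_bd_diamond \<Omega> \<tau> \<eta>2 g))" for g
  show thesis
  proof
    show "is_normal_trace \<Omega> v nv"
      using assms(1) F by (rule is_normal_trace_cong) (simp add: nv_def)
    show "nv g + ip (surf \<Omega>) \<eta>1 g + grad_bd_diamond \<Omega> \<tau> \<eta>2 g = 0" if g: "g \<in> H1_bd \<Omega> \<tau>" for g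
    proof (cases "g \<in> H_half \<Omega>")
      case True
      then obtain \<psi> w where \<psi>: "(\<psi>, w) \<in> gradient \<Omega>" "(\<psi>, g) \<in> trace_map \<Omega>" using H_halfE by metis
      \<comment> \<open>The adjoint condition holds for every \<open>h\<close> paired with
        \<open>g\<close>; the one selected by \<open>app\<close> makes the last boundary term
        literally \<open>grad_bd_diamond\<close>.\<close>
      have "(g, app (grad_bd \<Omega> \<tau>) g) \<in> grad_bd \<Omega> \<tau>" using g app_mem unfolding H1_bd_def by metis
      from cond[OF \<psi> this] have "ip (vol \<Omega>) f \<psi>
          = ipv (vol \<Omega>) v w + ip (surf \<Omega>) \<eta>1 g + grad_bd_diamond \<Omega> \<tau> \<eta>2 g"
        by (simp add: grad_bd_diamond_def)
      with Feq[OF \<psi>] True show ?thesis by (simp add: nv_def ip_uminus_left)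
    qed (simp add: nv_def)
  qed
qed

text \<open>\<open>app\<close> selects one tangential gradient of \<open>g\<close>;
  single-valuedness makes it equal almost everywhere to any other, so the pairing agrees. This
  carries the boundary condition, stated for the selected gradient, over to every \<open>h\<close>
  in the adjoint condition.\<close>

lemma grad_bd_diamond_eq:
  assumes "grad_bd_defined \<Omega> \<tau>" and gh: "(g, h) \<in> grad_bd \<Omega> \<tau>" and "\<eta> \<in> L2v (surf \<Omega>)"
  shows "grad_bd_diamond \<Omega> \<tau> \<eta> g = ipv (surf \<Omega>) \<eta> h"
proof -
  have gk: "(g, app (grad_bd \<Omega> \<tau>) g) \<in> grad_bd \<Omega> \<tau>" using gh app_mem by (metis DomainI)
  then have ae: "AE x in surf \<Omega>. app (grad_bd \<Omega> \<tau>) g x = h x"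
    using assms unfolding grad_bd_defined_def by blast
  have L: "h \<in> L2v (surf \<Omega>)" "app (grad_bd \<Omega> \<tau>) g \<in> L2v (surf \<Omega>)"
    using gh gk by (auto simp: grad_bd_def)
  have "ip (surf \<Omega>) (\<lambda>x. \<eta> x $ j) (\<lambda>x. app (grad_bd \<Omega> \<tau>) g x $ j) = ip (surf \<Omega>) (\<lambda>x. \<eta> x $ j) (\<lambda>x. h x $ j)"
    for j
    unfolding ip_def
  proof (rule integral_cong_AE)
    show "AE x in surf \<Omega>. cnj (\<eta> x $ j) * app (grad_bd \<Omega> \<tau>) g x $ j = cnj (\<eta> x $ j) * h x $ j"
      using ae by eventually_elim simp
  qed (intro borel_measurable_times L2_measurable L2_cnj L2v_component L assms(3))+
  then show ?thesis by (simp add: grad_bd_diamond_def ipv_def)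
qed

theorem theorem2p13:
  fixes \<Omega> :: "(real ^ 3) set" and \<tau> :: "real ^ 3 \<Rightarrow> (real ^ 3) ^ 2"
  assumes "open \<Omega>" and "bounded \<Omega>" and "lipschitz_boundary \<Omega>"
    and "tangent_frame \<Omega> \<tau>" and "grad_bd_defined \<Omega> \<tau>"
  shows "Domain (triple_adj \<Omega> \<tau>) =
           {(v, \<eta>1, \<eta>2). v \<in> Domain (divergence \<Omega>) \<and> \<eta>1 \<in> L2 (surf \<Omega>) \<and> \<eta>2 \<in> L2v (surf \<Omega>) \<and>
              (\<exists>nv. is_normal_trace \<Omega> v nv \<and>
                 (\<forall>g\<in>H1_bd \<Omega> \<tau>. nv g + ip (surf \<Omega>) \<eta>1 g + grad_bd_diamond \<Omega> \<tau> \<eta>2 g = 0))}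
         \<and> (\<forall>v \<eta>1 \<eta>2 f. ((v, \<eta>1, \<eta>2), f) \<in> triple_adj \<Omega> \<tau> \<longrightarrow> (v, \<lambda>x. - f x) \<in> divergence \<Omega>)"
    (is "?L = ?R \<and> ?D")
proof
  show ?D using triple_adj_divergence[OF assms(1)] by blast
  show "?L = ?R"
  proof (intro set_eqI iffI; clarify)
    fix v \<eta>1 \<eta>2 f
    assume adj: "((v, \<eta>1, \<eta>2), f) \<in> triple_adj \<Omega> \<tau>"
    obtain nv where "is_normal_trace \<Omega> v nv"
      "\<And>g. g \<in> H1_bd \<Omega> \<tau> \<Longrightarrow> nv g + ip (surf \<Omega>) \<eta>1 g + grad_bd_diamond \<Omega> \<tau> \<eta>2 g = 0"
      using triple_adj_normal_trace[OF assms(1) adj] by blast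
    then show "v \<in> Domain (divergence \<Omega>) \<and> \<eta>1 \<in> L2 (surf \<Omega>) \<and> \<eta>2 \<in> L2v (surf \<Omega>) \<and>
        (\<exists>nv. is_normal_trace \<Omega> v nv \<and>
          (\<forall>g\<in>H1_bd \<Omega> \<tau>. nv g + ip (surf \<Omega>) \<eta>1 g + grad_bd_diamond \<Omega> \<tau> \<eta>2 g = 0))"
      using triple_adj_divergence[OF assms(1) adj] adj unfolding mem_triple_adj by blast
  next
    fix v \<eta>1 \<eta>2 d' nv
    assume \<eta>: "\<eta>1 \<in> L2 (surf \<Omega>)" "\<eta>2 \<in> L2v (surf \<Omega>)" and nv: "is_normal_trace \<Omega> v nv"
      and zero: "\<forall>g\<in>H1_bd \<Omega> \<tau>. nv g + ip (surf \<Omega>) \<eta>1 g + grad_bd_diamond \<Omega> \<tau> \<eta>2 g = 0"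
    \<comment> \<open>This \<open>d\<close> is the one attached to \<open>nv\<close>, for which the
      defining formula of the normal trace is available; its negative will be the value of the
      adjoint.\<close>
    obtain d where vd: "(v, d) \<in> divergence \<Omega>" and
      F: "\<And>\<psi> w g. (\<psi>, w) \<in> gradient \<Omega> \<Longrightarrow> (\<psi>, g) \<in> trace_map \<Omega> \<Longrightarrow>
        nv g = ip (vol \<Omega>) d \<psi> + ipv (vol \<Omega>) v w"
      using nv unfolding is_normal_trace_def by blast
    have L: "v \<in> L2v (vol \<Omega>)" "d \<in> L2 (vol \<Omega>)" using vd by (auto simp: divergence_def)
    have "ipv (vol \<Omega>) v w + ip (surf \<Omega>) \<eta>1 g + ipv (surf \<Omega>) \<eta>2 h = ip (vol \<Omega>) (\<lambda>x. - d x) u"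
      if uw: "(u, w) \<in> gradient \<Omega>" "(u, g) \<in> trace_map \<Omega>" and gh: "(g, h) \<in> grad_bd \<Omega> \<tau>" for u w g h
    proof -
      have "g \<in> H1_bd \<Omega> \<tau>" using gh by (auto simp: H1_bd_def)
      \<comment> \<open>The boundary condition at \<open>g\<close>, rewritten for the given
        \<open>h\<close>. Substituting the normal trace formula for \<open>nv g\<close> then yields
        the adjoint identity.\<close>
      then have "nv g + ip (surf \<Omega>) \<eta>1 g + ipv (surf \<Omega>) \<eta>2 h = 0"
        using zero grad_bd_diamond_eq[OF assms(5) gh \<eta>(2)] by metis
      then show ?thesis
        unfolding F[OF uw] by (simp add: ip_uminus_left eq_neg_iff_add_eq_0 algebra_simps)
    qed
    moreover have "(\<lambda>x. - d x) \<in> L2 (vol \<Omega>)" using L2_lincomb[OF L(2) L(2), of "-1" 0] by simp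
    ultimately have "((v, \<eta>1, \<eta>2), \<lambda>x. - d x) \<in> triple_adj \<Omega> \<tau>"
      using L \<eta> unfolding mem_triple_adj by blast
    then show "(v, \<eta>1, \<eta>2) \<in> Domain (triple_adj \<Omega> \<tau>)" by blast
  qed
qed

end
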